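(* Let $\Phi=I_0-I$, where $I_0,I\in C^1(X,\mathbb{R})$ and $I_0(0)=I(0)=0$. Assume that: (1) $I_0$ and $u\mapsto I_0'(u)u$ are weakly lower semicontinuous and $I'$ is completely continuous, i.e. $I'(u_n)\to I'(u)$ in $X^*$ if $u_n\rightharpoonup u$ in $X$. (2) There exist $C>0$ and $\eta>1$ such that $I_0'(u)u\geq C\|u\|^{\eta}$ for every $u\in\overline{Y}$, and $I'(u)=o(\|u\|^{\eta-1})$ as $u\to 0$ in $\overline{Y}$. (3) $I(u)=I'(u)u=0$ for every $u\in\partial Y$. (4) There exists $\sigma>1$ such that, for every $u\in Y$, the maps $t\mapsto\frac{I_0'(tu)u}{t^{\sigma-1}}$ and $t\mapsto\frac{I'(tu)u}{t^{\sigma-1}}$ are nonincreasing and increasing in $(0,\infty)$, respectively; moreover $\lim_{t\to\infty}\frac{I_0(tu)}{t^{\sigma}}<\infty=\lim_{t\to\infty}\frac{I(tu)}{t^{\sigma}}$ uniformly for $u$ on weakly compact subsets of $Y$. Then $c:=\inf_{\mathcal{N}\cap Y}\Phi$ is positive and achieved by a critical point of $\Phi$. If, in addition, $I'(u)u\leq 0<I_0'(u)u$ for $u\in X\setminus Y$ with $u\neq 0$, then $c$ is the ground state level of $\Phi$.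
   Context: $X$ is a reflexive Banach space. $Y\subset X\setminus\{0\}$ is a nonempty open cone, i.e. a nonempty open set such that $tu\in Y$ for every $t>0$ and $u\in Y$. $\partial Y$ and $\overline{Y}$ denote the boundary and the closure of $Y$ in the weak topology of $X$. $\mathcal{N}=\{u\in X\setminus\{0\}:\Phi'(u)u=0\}$. "Increasing" means strictly increasing. The uniform limits in (4) mean: for each weakly compact $K\subset Y$, $I_0(tu)/t^{\sigma}$ is bounded above by a constant for all $u\in K$ and all large $t$ (uniformly in $u\in K$), and $I(tu)/t^{\sigma}\to\infty$ as $t\to\infty$ uniformly for $u\in K$. A ground state is a nontrivial critical point of $\Phi$ minimizing $\Phi$ over the set of all nontrivial critical points; a number is the ground state level of $\Phi$ if it is the value of $\Phi$ at a ground state. *)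

theory Defs
  imports "HOL-Analysis.Analysis" "HOL-Library.Landau_Symbols"
begin

definition reflexive_space :: "'a::real_normed_vector itself \<Rightarrow> bool" where
  "reflexive_space _ \<longleftrightarrow>
     (\<forall>\<phi> :: ('a \<Rightarrow>\<^sub>L real) \<Rightarrow>\<^sub>L real. \<exists>x::'a. \<forall>f. blinfun_apply \<phi> f = blinfun_apply f x)"

text \<open>The initial topology with respect to all bounded linear functionals: \<open>euclidean\<close> on the
  function space \<open>('a \<Rightarrow>\<^sub>L real) \<Rightarrow> real\<close> is the topology of pointwise convergence.\<close>

definition weak_topology :: "'a::real_normed_vector topology" where
  "weak_topology = pullback_topology UNIV (\<lambda>u f. blinfun_apply f u :: real) euclidean"

abbreviation weakly_converges :: "(nat \<Rightarrow> 'a::real_normed_vector) \<Rightarrow> 'a \<Rightarrow> bool" where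
  "weakly_converges s u \<equiv> limitin weak_topology s u sequentially"

text \<open>Sequential weak lower semicontinuity; as a hypothesis it is implied by lower semicontinuity
  with respect to the weak topology.\<close>

definition weakly_lsc :: "('a::real_normed_vector \<Rightarrow> real) \<Rightarrow> bool" where
  "weakly_lsc F \<longleftrightarrow>
     (\<forall>s u. weakly_converges s u \<longrightarrow> ereal (F u) \<le> liminf (\<lambda>n. ereal (F (s n))))"

definition completely_continuous ::
    "('a::real_normed_vector \<Rightarrow> 'b::real_normed_vector) \<Rightarrow> bool" where
  "completely_continuous T \<longleftrightarrow>
     (\<forall>s u. weakly_converges s u \<longrightarrow> (\<lambda>n. T (s n)) \<longlonglongrightarrow> T u)"

definition C1_functional ::
    "('a::real_normed_vector \<Rightarrow> real) \<Rightarrow> ('a \<Rightarrow> 'a \<Rightarrow>\<^sub>L real) \<Rightarrow> bool" where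
  "C1_functional F F' \<longleftrightarrow>
     (\<forall>u. (F has_derivative blinfun_apply (F' u)) (at u)) \<and> continuous_on UNIV F'"

text \<open>Openness is with respect to the norm. Unlike for the library's \<open>cone\<close>, the origin is
  excluded.\<close>

definition open_cone :: "'a::real_normed_vector set \<Rightarrow> bool" where
  "open_cone Y \<longleftrightarrow> Y \<noteq> {} \<and> open Y \<and> 0 \<notin> Y \<and> (\<forall>t>0. \<forall>u\<in>Y. t *\<^sub>R u \<in> Y)"

definition nehari_set :: "('a::real_normed_vector \<Rightarrow> real) \<Rightarrow> 'a set" where
  "nehari_set \<Phi> = {u. u \<noteq> 0 \<and> frechet_derivative \<Phi> (at u) u = 0}"

definition critical_point :: "('a::real_normed_vector \<Rightarrow> real) \<Rightarrow> 'a \<Rightarrow> bool" where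
  "critical_point \<Phi> u \<longleftrightarrow> (\<Phi> has_derivative (\<lambda>v. 0)) (at u)"

definition ground_state :: "('a::real_normed_vector \<Rightarrow> real) \<Rightarrow> 'a \<Rightarrow> bool" where
  "ground_state \<Phi> u \<longleftrightarrow>
     u \<noteq> 0 \<and> critical_point \<Phi> u \<and> (\<forall>v. v \<noteq> 0 \<and> critical_point \<Phi> v \<longrightarrow> \<Phi> u \<le> \<Phi> v)"

definition ground_state_level :: "('a::real_normed_vector \<Rightarrow> real) \<Rightarrow> real \<Rightarrow> bool" where
  "ground_state_level \<Phi> c \<longleftrightarrow> (\<exists>u. ground_state \<Phi> u \<and> \<Phi> u = c)"

end

theory Submission
  imports Defs "HOL-Complex_Analysis.Great_Picard"
begin

text \<open>
  Fix \<open>u \<in> Y\<close> and look at \<open>\<Phi>\<close> along the ray \<open>t \<mapsto> t u\<close>. Near \<open>0\<close> the coercivity of \<open>I0'\<close> beats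
  \<open>I'\<close>, so \<open>\<Phi>\<close> increases; for large \<open>t\<close> the superhomogeneous \<open>I\<close> wins, so \<open>\<Phi>\<close> is negative; and the
  derivative divided by \<open>t powr (\<sigma> - 1)\<close> is strictly decreasing, so it changes sign once. Hence each
  ray in \<open>Y\<close> meets the Nehari set exactly at its unique maximum of \<open>\<Phi>\<close>
  (\<open>ray_meets_nehari_set\<close>, \<open>nehari_maximizes_on_ray\<close>), where \<open>\<Phi>\<close> is positive. The infimum \<open>c\<close> is
  therefore a minimax over rays, and every upper bound on \<open>\<Phi>\<close> at a Nehari point is an upper bound on
  its whole ray.

  This is what makes minimizing sequences compact. If one were unbounded, its normalization would
  have a weak limit \<open>v\<close> in the weak closure of \<open>Y\<close>. For \<open>v \<in> Y\<close> the growth of \<open>I\<close> beyond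
  \<open>I0\<close>, uniform on weakly compact sets, forces negative values of \<open>\<Phi>\<close>; for \<open>v \<in> \<partial>Y\<close> the term \<open>I\<close>
  disappears along the ray in the limit, and the remaining \<open>I0\<close>, at least \<open>C / \<eta> * t powr \<eta>\<close>, is unbounded in \<open>t\<close>
  (\<open>nehari_sublevel_bounded\<close>). So there is a weak limit \<open>u\<close> of the sequence itself. It cannot lie
  on \<open>\<partial>Y\<close>: there \<open>I' u u = 0\<close>, whereas \<open>I' u u\<close> stays away from \<open>0\<close> on the Nehari set
  (\<open>weak_limit_of_nehari_sequence\<close>). The ray of \<open>u \<in> Y\<close> then carries a Nehari point \<open>t u\<close>, and weak
  lower semicontinuity together with the ray maximality of the sequence gives \<open>\<Phi> (t u) \<le> c\<close>
  (\<open>nehari_minimum_attained\<close>). The Nehari set need not be a manifold, so criticality of a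
  minimizer is shown by perturbing the ray instead of by Lagrange multipliers
  (\<open>nehari_minimizer_critical\<close>). Finally, under the sign condition outside \<open>Y\<close> every nontrivial
  critical point lies in \<open>Y\<close>, hence in the Nehari set, so its level is at least \<open>c\<close>.

  The functional analysis behind the weak limits is that bounded sequences in a reflexive space have
  weakly convergent subsequences. It is derived from a Hahn--Banach theorem for sublinear
  functionals: applied to the norm it yields a countable family of functionals separating the
  points of the closed span of the sequence; applied to the upper limit along the sequence it
  yields elements of the bidual, hence of the space, that serve as weak cluster points; and applied
  to the distance from the span it shows that these points lie in the span.
\<close>

section \<open>Dominated linear functionals\<close>

definition sublinear :: "('a::real_vector \<Rightarrow> real) \<Rightarrow> bool" where
  "sublinear p \<longleftrightarrow> (\<forall>x y. p (x + y) \<le> p x + p y) \<and> (\<forall>t x. 0 \<le> t \<longrightarrow> p (t *\<^sub>R x) = t * p x)"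

lemma sublinear_add: "sublinear p \<Longrightarrow> p (x + y) \<le> p x + p y"
  by (simp add: sublinear_def)

lemma sublinear_scaleR: "sublinear p \<Longrightarrow> 0 \<le> t \<Longrightarrow> p (t *\<^sub>R x) = t * p x"
  by (simp add: sublinear_def)

lemma sublinear_zero: "sublinear p \<Longrightarrow> p 0 = 0"
  using sublinear_scaleR[of p 0 0] by simp

lemma sublinear_minus: "sublinear p \<Longrightarrow> - p (- x) \<le> p x"
  using sublinear_add[of p x "- x"] sublinear_zero[of p] by simp

text \<open>Positive homogeneity only needs one inequality, because scaling by \<open>t\<close>
  can be undone by scaling by \<open>1 / t\<close>.\<close>

lemma sublinearI:
  assumes add: "\<And>x y. p (x + y) \<le> p x + p y"
    and zero: "p 0 = 0"
    and scale: "\<And>t x. t > 0 \<Longrightarrow> p (t *\<^sub>R x) \<le> t * p x"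
  shows "sublinear p"
  unfolding sublinear_def
proof (intro conjI allI impI)
  fix t :: real and x assume "0 \<le> t"
  show "p (t *\<^sub>R x) = t * p x"
  proof (cases "t = 0")
    case False
    with \<open>0 \<le> t\<close> have "t > 0" by simp
    have "p ((1 / t) *\<^sub>R (t *\<^sub>R x)) \<le> (1 / t) * p (t *\<^sub>R x)"
      by (rule scale) (use \<open>t > 0\<close> in simp)
    then have "t * p x \<le> p (t *\<^sub>R x)"
      using \<open>t > 0\<close> by (simp add: field_simps)
    with scale[OF \<open>t > 0\<close>, of x] show ?thesis by simp
  qed (simp add: zero)
qed (rule add)

text \<open>The sublinear functional below \<open>p\<close> that is as small as possible at
  \<open>- y\<close>: it is additive in the direction \<open>y\<close>. A linear functional is
  below \<open>p\<close> and equal to it at \<open>y\<close> iff it is below \<open>tilt p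
  y\<close>.\<close>

definition tilt :: "('a::real_vector \<Rightarrow> real) \<Rightarrow> 'a \<Rightarrow> 'a \<Rightarrow> real" where
  "tilt p y x = (INF t\<in>{0..}. p (x + t *\<^sub>R y) - t * p y)"

lemma tilt_lower:
  assumes "sublinear p" "0 \<le> t"
  shows "- p (- x) \<le> p (x + t *\<^sub>R y) - t * p y"
  using sublinear_add[OF assms(1), of "x + t *\<^sub>R y" "- x"] sublinear_scaleR[OF assms, of y] by simp

lemma tilt_le:
  assumes "sublinear p" "0 \<le> t"
  shows "tilt p y x \<le> p (x + t *\<^sub>R y) - t * p y"
  unfolding tilt_def
  by (rule cINF_lower) (use assms tilt_lower in \<open>auto intro!: bdd_belowI2[where m = "- p (- x)"]\<close>)

lemma tilt_greatest:
  assumes "\<And>t. 0 \<le> t \<Longrightarrow> m \<le> p (x + t *\<^sub>R y) - t * p y"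
  shows "m \<le> tilt p y x"
  unfolding tilt_def by (rule cINF_greatest) (use assms in auto)

lemma sublinear_tilt:
  assumes p: "sublinear p"
  shows "sublinear (tilt p y)"
proof (rule sublinearI)
  fix x z
  have le: "tilt p y (x + z) \<le> (p (x + s *\<^sub>R y) - s * p y) + (p (z + t *\<^sub>R y) - t * p y)"
    if "0 \<le> s" "0 \<le> t" for s t
    using tilt_le[OF p, of "s + t" y "x + z"] that
      sublinear_add[OF p, of "x + s *\<^sub>R y" "z + t *\<^sub>R y"]
    by (simp add: algebra_simps)
  have "tilt p y (x + z) - tilt p y x \<le> p (z + t *\<^sub>R y) - t * p y" if "0 \<le> t" for t
  proof -
    have "tilt p y (x + z) - (p (z + t *\<^sub>R y) - t * p y) \<le> tilt p y x"
      by (rule tilt_greatest) (use le that in force)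
    then show ?thesis by simp
  qed
  then have "tilt p y (x + z) - tilt p y x \<le> tilt p y z"
    by (rule tilt_greatest)
  then show "tilt p y (x + z) \<le> tilt p y x + tilt p y z" by simp
next
  have "0 \<le> tilt p y 0"
    by (rule tilt_greatest) (simp add: sublinear_scaleR[OF p])
  moreover have "tilt p y 0 \<le> 0"
    using tilt_le[OF p, of 0 y 0] sublinear_zero[OF p] by simp
  ultimately show "tilt p y 0 = 0" by simp
next
  fix t :: real and x assume "t > 0"
  have "tilt p y (t *\<^sub>R x) / t \<le> tilt p y x"
  proof (rule tilt_greatest)
    fix s :: real assume "0 \<le> s"
    then have "tilt p y (t *\<^sub>R x) \<le> p (t *\<^sub>R x + (t * s) *\<^sub>R y) - t * s * p y"
      using tilt_le[OF p, of "t * s" y "t *\<^sub>R x"] \<open>t > 0\<close> by simp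
    also have "p (t *\<^sub>R x + (t * s) *\<^sub>R y) = t * p (x + s *\<^sub>R y)"
      using sublinear_scaleR[OF p, of t "x + s *\<^sub>R y"] \<open>t > 0\<close> by (simp add: scaleR_add_right)
    finally show "tilt p y (t *\<^sub>R x) / t \<le> p (x + s *\<^sub>R y) - s * p y"
      using \<open>t > 0\<close> by (simp add: field_simps)
  qed
  then show "tilt p y (t *\<^sub>R x) \<le> t * tilt p y x"
    using \<open>t > 0\<close> by (simp add: field_simps)
qed

text \<open>Tilting never increases \<open>q\<close>, so a minimal \<open>q\<close> equals all
  of its tilts; the choice \<open>t = 1\<close> in the infimum then reads \<open>q x \<le> q (x
  + y) - q y\<close>, the missing half of additivity.\<close>

lemma minimal_sublinear_is_linear:
  assumes q: "sublinear q"
    and minimal: "\<And>r. sublinear r \<Longrightarrow> (\<And>x. r x \<le> q x) \<Longrightarrow> r = q"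
  shows "linear q"
proof -
  have "tilt q y x \<le> q x" for x y
    using tilt_le[OF q, of 0 y x] by simp
  then have tilt: "tilt q y = q" for y
    using minimal[OF sublinear_tilt[OF q]] by blast
  have add: "q (x + y) = q x + q y" for x y
    using tilt_le[OF q, of 1 y x] sublinear_add[OF q, of x y] by (simp add: tilt)
  have neg: "q (- x) = - q x" for x
    using add[of x "- x"] sublinear_zero[OF q] by simp
  have "q (t *\<^sub>R x) = t * q x" for t x
  proof (cases "0 \<le> t")
    case False
    then have "q ((- t) *\<^sub>R x) = - t * q x"
      by (intro sublinear_scaleR[OF q]) simp
    then show ?thesis using neg[of "t *\<^sub>R x"] by simp
  qed (simp add: sublinear_scaleR[OF q])
  then show ?thesis
    by (intro linearI) (simp_all add: add)
qed

text \<open>Zorn's lemma: a chain of sublinear functionals below \<open>p\<close> is bounded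
  below at \<open>x\<close> by \<open>- p (- x)\<close>, and its pointwise infimum is
  subadditive because of any two members the smaller one bounds both terms.\<close>

lemma minimal_sublinear_exists:
  assumes p: "sublinear p"
  obtains q where "sublinear q" "\<And>x. q x \<le> p x"
    "\<And>r. sublinear r \<Longrightarrow> (\<And>x. r x \<le> q x) \<Longrightarrow> r = q"
proof -
  define A where "A = {q. sublinear q \<and> (\<forall>x. q x \<le> p x)}"
  define P where "P = (\<lambda>q r :: 'a \<Rightarrow> real. \<forall>x. r x \<le> q x)"
  have "\<exists>m\<in>A. \<forall>a\<in>A. P m a \<longrightarrow> a = m"
  proof (rule predicate_Zorn)
    show "partial_order_on A (relation_of P A)"
      by (rule partial_order_on_relation_ofI)
        (auto simp: P_def fun_eq_iff intro: order_trans antisym)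
  next
    fix C assume C: "C \<in> Chains (relation_of P A)"
    have chain: "P q r \<or> P r q" if "q \<in> C" "r \<in> C" for q r
      using C that by (auto simp: Chains_def relation_of_def)
    have sub: "sublinear q" "q x \<le> p x" if "q \<in> C" for q x
      using C that by (auto simp: Chains_def relation_of_def A_def)
    show "\<exists>u\<in>A. \<forall>a\<in>C. P a u"
    proof (cases "C = {}")
      case True
      then show ?thesis using p by (auto simp: A_def)
    next
      case False
      define r where "r x = (INF q\<in>C. q x)" for x
      have bound: "- p (- x) \<le> q x" if "q \<in> C" for q x
        using sublinear_minus[OF sub(1)[OF that], of x] sub(2)[OF that, of "- x"] by simp
      have r_le: "r x \<le> q x" if "q \<in> C" for q x
        unfolding r_def
        by (rule cINF_lower[OF _ that]) (use bound in \<open>auto intro!: bdd_belowI2\<close>)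
      have r_ge: "m \<le> r x" if "\<And>q. q \<in> C \<Longrightarrow> m \<le> q x" for m x
        unfolding r_def by (rule cINF_greatest[OF False]) (rule that)
      have "sublinear r"
      proof (rule sublinearI)
        fix x y
        have le: "r (x + y) \<le> q1 x + q2 y" if "q1 \<in> C" "q2 \<in> C" for q1 q2
        proof -
          have "\<exists>q\<in>C. q x \<le> q1 x \<and> q y \<le> q2 y"
            using chain[OF that] that unfolding P_def by blast
          then obtain q where "q \<in> C" "q x \<le> q1 x" "q y \<le> q2 y" by blast
          then show ?thesis
            using r_le[of q "x + y"] sublinear_add[OF sub(1), of q x y] by linarith
        qed
        have "r (x + y) - r x \<le> q2 y" if "q2 \<in> C" for q2
        proof -
          have "r (x + y) - q2 y \<le> r x"
            by (rule r_ge) (use le that in force)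
          then show ?thesis by simp
        qed
        then have "r (x + y) - r x \<le> r y" by (rule r_ge)
        then show "r (x + y) \<le> r x + r y" by simp
      next
        show "r 0 = 0"
          unfolding r_def using False sub(1) by (simp add: sublinear_zero cong: INF_cong)
      next
        fix t :: real and x assume "t > 0"
        have "r (t *\<^sub>R x) / t \<le> r x"
        proof (rule r_ge)
          fix q assume "q \<in> C"
          then show "r (t *\<^sub>R x) / t \<le> q x"
            using r_le[of q "t *\<^sub>R x"] sublinear_scaleR[OF sub(1), of q t x] \<open>t > 0\<close>
            by (simp add: field_simps)
        qed
        then show "r (t *\<^sub>R x) \<le> t * r x"
          using \<open>t > 0\<close> by (simp add: field_simps)
      qed
      moreover have "r x \<le> p x" for x
        using r_le sub(2) False by (meson all_not_in_conv order_trans)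
      ultimately show ?thesis
        using r_le by (auto simp: A_def P_def)
    qed
  qed
  then obtain q where q: "q \<in> A" and min: "\<And>r. r \<in> A \<Longrightarrow> P q r \<Longrightarrow> r = q" by blast
  have "r = q" if "sublinear r" "\<And>x. r x \<le> q x" for r
  proof (rule min)
    show "r \<in> A" using that q unfolding A_def by (auto intro: order_trans)
  qed (use that in \<open>simp add: P_def\<close>)
  with q that show thesis by (auto simp: A_def)
qed

text \<open>The Hahn--Banach theorem without extending from a subspace: a minimal, hence linear,
  functional below \<open>tilt p z\<close> takes at \<open>- z\<close> a value of at most
  \<open>- p z\<close>.\<close>

theorem hahn_banach_touching:
  fixes p :: "'a::real_vector \<Rightarrow> real"
  assumes p: "sublinear p"
  obtains f where "linear f" "\<And>x. f x \<le> p x" "f z = p z"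
proof -
  obtain q where q: "sublinear q" "\<And>x. q x \<le> tilt p z x"
    and min: "\<And>r. sublinear r \<Longrightarrow> (\<And>x. r x \<le> q x) \<Longrightarrow> r = q"
    using minimal_sublinear_exists[OF sublinear_tilt[OF p]] by metis
  have lin: "linear q" by (rule minimal_sublinear_is_linear[OF q(1) min])
  have le: "q x \<le> p x" for x
    using q(2)[of x] tilt_le[OF p, of 0 z x] by simp
  have "q (- z) \<le> - p z"
    using q(2)[of "- z"] tilt_le[OF p, of 1 z "- z"] sublinear_zero[OF p] by simp
  then have "q z = p z"
    using le[of z] linear_neg[OF lin, of z] by simp
  with lin le that show thesis by blast
qed

lemma dominated_functional_bounded:
  fixes f :: "'a::real_normed_vector \<Rightarrow> real"
  assumes "linear f" "\<And>x. f x \<le> B * norm x" "0 \<le> B"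
  obtains g :: "'a \<Rightarrow>\<^sub>L real" where "blinfun_apply g = f" "norm g \<le> B"
proof -
  have abs: "norm (f x) \<le> B * norm x" for x
    using assms(2)[of x] assms(2)[of "- x"] linear_neg[OF assms(1), of x] by simp
  then have "bounded_linear f"
    using assms(1) by (intro bounded_linear_intro[where K = B])
      (auto simp: linear_add linear_scale mult.commute)
  then have "blinfun_apply (Blinfun f) = f"
    by (rule bounded_linear_Blinfun_apply)
  moreover from this have "norm (Blinfun f) \<le> B"
    using assms(3) abs by (intro norm_blinfun_bound) auto
  ultimately show thesis by (rule that)
qed

text \<open>A linear functional below the norm that touches it at \<open>x\<close>.\<close>

lemma norming_functional:
  fixes x :: "'a::real_normed_vector"
  obtains f :: "'a \<Rightarrow>\<^sub>L real" where "norm f \<le> 1" "f x = norm x"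
proof -
  have "sublinear (norm :: 'a \<Rightarrow> real)"
    by (auto simp: sublinear_def norm_triangle_ineq)
  then obtain f where "linear f" "\<And>y. f y \<le> norm (y :: 'a)" "f x = norm x"
    using hahn_banach_touching[where z = x] by metis
  then show thesis
    using dominated_functional_bounded[of f 1] that by (metis mult_1 zero_le_one)
qed

text \<open>The distance to a subspace is sublinear, vanishes on the subspace and is positive
  off its closure; a linear functional below it that touches it at \<open>x\<close> inherits all
  of this.\<close>

lemma separating_functional:
  fixes S :: "'a::real_normed_vector set"
  assumes S: "subspace S" and x: "x \<notin> closure S"
  obtains f :: "'a \<Rightarrow>\<^sub>L real" where "\<And>y. y \<in> S \<Longrightarrow> f y = 0" "f x > 0"
proof -
  have ne: "S \<noteq> {}" using subspace_0[OF S] by blast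
  let ?d = "\<lambda>y. infdist y S"
  have inf_ge: "m \<le> ?d y" if "\<And>s. s \<in> S \<Longrightarrow> m \<le> dist y s" for m y
    unfolding infdist_notempty[OF ne] by (rule cINF_greatest[OF ne]) (rule that)
  have "sublinear ?d"
  proof (rule sublinearI)
    fix y z
    have le: "?d (y + z) \<le> dist y s + dist z t" if "s \<in> S" "t \<in> S" for s t
    proof -
      have "?d (y + z) \<le> dist (y + z) (s + t)"
        by (rule infdist_le[OF subspace_add[OF S that]])
      also have "\<dots> \<le> dist y s + dist z t" by (rule dist_triangle_add)
      finally show ?thesis .
    qed
    have "?d (y + z) - ?d y \<le> dist z t" if "t \<in> S" for t
    proof -
      have "?d (y + z) - dist z t \<le> ?d y"
        by (rule inf_ge) (use le that in force)
      then show ?thesis by simp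
    qed
    then have "?d (y + z) - ?d y \<le> ?d z" by (rule inf_ge)
    then show "?d (y + z) \<le> ?d y + ?d z" by simp
  next
    show "?d 0 = 0" using subspace_0[OF S] by simp
  next
    fix t :: real and y assume "t > 0"
    have "?d (t *\<^sub>R y) / t \<le> ?d y"
    proof (rule inf_ge)
      fix s assume "s \<in> S"
      then have "?d (t *\<^sub>R y) \<le> dist (t *\<^sub>R y) (t *\<^sub>R s)"
        by (intro infdist_le subspace_scale[OF S])
      also have "\<dots> = t * dist y s"
        using \<open>t > 0\<close> by (simp add: dist_norm flip: scaleR_diff_right)
      finally show "?d (t *\<^sub>R y) / t \<le> dist y s"
        using \<open>t > 0\<close> by (simp add: field_simps)
    qed
    then show "?d (t *\<^sub>R y) \<le> t * ?d y"
      using \<open>t > 0\<close> by (simp add: field_simps)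
  qed
  then obtain f where f: "linear f" "\<And>y. f y \<le> ?d y" "f x = ?d x"
    using hahn_banach_touching[where z = x] by metis
  have "f y \<le> 1 * norm y" for y
    using f(2)[of y] infdist_le[OF subspace_0[OF S], of y] by (simp add: dist_norm)
  then obtain g :: "'a \<Rightarrow>\<^sub>L real" where g: "blinfun_apply g = f"
    using dominated_functional_bounded[OF f(1)] by (metis zero_le_one)
  have "f y = 0" if "y \<in> S" for y
    using f(2)[of y] f(2)[of "- y"] that subspace_neg[OF S that] linear_neg[OF f(1), of y] by simp
  moreover have "?d x \<noteq> 0"
    using x in_closure_iff_infdist_zero[OF ne] by blast
  then have "f x > 0" using f(3) infdist_nonneg[of x S] by simp
  ultimately show thesis using that[of g] by (simp add: g)
qed

section \<open>Weak sequential compactness in reflexive spaces\<close>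

lemma weakly_converges_iff:
  "weakly_converges s u \<longleftrightarrow> (\<forall>f :: 'a::real_normed_vector \<Rightarrow>\<^sub>L real. (\<lambda>n. f (s n)) \<longlonglongrightarrow> f u)"
proof -
  let ?J = "\<lambda>(u::'a) (f :: 'a \<Rightarrow>\<^sub>L real). blinfun_apply f u"
  have "weakly_converges s u \<longleftrightarrow> limitin euclidean (\<lambda>n. ?J (s n)) (?J u) sequentially"
    unfolding limitin_def weak_topology_def openin_pullback_topology topspace_pullback_topology
    by auto
  also have "\<dots> \<longleftrightarrow> (\<forall>f :: 'a \<Rightarrow>\<^sub>L real. (\<lambda>n. f (s n)) \<longlonglongrightarrow> f u)"
    unfolding euclidean_product_topology[symmetric] limitin_componentwise by simp
  finally show ?thesis .
qed

lemma topspace_weak_topology [simp]: "topspace weak_topology = UNIV"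
  unfolding weak_topology_def topspace_pullback_topology by simp

lemma continuous_map_weak_topology_scaleR:
  "continuous_map weak_topology weak_topology ((*\<^sub>R) t :: 'a \<Rightarrow> 'a::real_normed_vector)"
proof -
  have "continuous_map weak_topology euclidean (\<lambda>u (f :: 'a \<Rightarrow>\<^sub>L real). f (t *\<^sub>R u))"
  proof -
    have "continuous_map weak_topology euclidean
        ((\<lambda>\<phi> f. t * \<phi> f) \<circ> (\<lambda>u (f :: 'a \<Rightarrow>\<^sub>L real). blinfun_apply f u))"
      unfolding weak_topology_def
      by (rule continuous_map_pullback)
        (auto intro!: continuous_on_coordinatewise_then_product continuous_intros
          continuous_on_product_coordinates)
    then show ?thesis by (simp add: o_def blinfun.scaleR_right)
  qed
  then show ?thesis
    unfolding weak_topology_def by (intro continuous_map_pullback') (auto simp: o_def)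
qed

lemma homeomorphic_map_weak_topology_scaleR:
  assumes "t \<noteq> 0"
  shows "homeomorphic_map weak_topology weak_topology ((*\<^sub>R) t)"
  using assms
  by (intro homeomorphic_maps_imp_map[where g = "(*\<^sub>R) (inverse t)"])
    (auto simp: homeomorphic_maps_def continuous_map_weak_topology_scaleR)

text \<open>Dilations are weak homeomorphisms that preserve the cone.\<close>

lemma weak_frontier_scaleR:
  assumes scale: "\<And>t u. t > 0 \<Longrightarrow> u \<in> Y \<Longrightarrow> t *\<^sub>R u \<in> Y"
    and t: "t > 0" and u: "u \<in> weak_topology frontier_of Y"
  shows "t *\<^sub>R u \<in> weak_topology frontier_of Y"
proof -
  have "Y \<subseteq> (*\<^sub>R) t ` Y"
  proof
    fix y assume "y \<in> Y"
    then have "inverse t *\<^sub>R y \<in> Y" using scale t by simp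
    then show "y \<in> (*\<^sub>R) t ` Y" using t by (intro image_eqI[of _ _ "inverse t *\<^sub>R y"]) auto
  qed
  then have "(*\<^sub>R) t ` Y = Y" using scale t by auto
  then have "weak_topology frontier_of Y = (*\<^sub>R) t ` (weak_topology frontier_of Y)"
    using homeomorphic_map_frontier_of[OF homeomorphic_map_weak_topology_scaleR, of t Y] t by simp
  then show ?thesis using u by blast
qed

lemma weak_limit_in_closure:
  assumes "weakly_converges s u" "\<And>n. s n \<in> Y"
  shows "u \<in> weak_topology closure_of Y"
  by (rule limitin_closedin[OF assms(1) closedin_closure_of])
    (use assms(2) closure_of_subset[of Y weak_topology] in \<open>auto intro!: always_eventually\<close>)

lemma weakly_compact_sequence_with_limit:
  assumes "weakly_converges s u"
  shows "compactin weak_topology (insert u (range s))"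
  by (rule compactin_sequence_with_limit[OF assms]) auto

text \<open>\<open>Q\<close> consists of the rational linear combinations of the sequence, and
  its closure is the closed linear span.\<close>

lemma separable_closed_span:
  fixes s :: "nat \<Rightarrow> 'a::real_normed_vector"
  obtains Q where "countable Q" "range s \<subseteq> closure Q" "subspace (closure Q)"
proof -
  let ?comb = "\<lambda>l. \<Sum>(c, i)\<leftarrow>l. real_of_rat c *\<^sub>R s i"
  define Q where "Q = range ?comb"
  have "s i \<in> Q" for i
    unfolding Q_def by (rule range_eqI[of _ _ "[(1, i)]"]) simp
  then have "range s \<subseteq> closure Q" using closure_subset by blast
  moreover have "subspace (closure Q)"
    unfolding subspace_def
  proof (intro conjI ballI allI)
    have "0 \<in> Q" unfolding Q_def by (rule range_eqI[of _ _ "[]"]) simp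
    then show "0 \<in> closure Q" using closure_subset by blast
  next
    fix x y assume "x \<in> closure Q" "y \<in> closure Q"
    then obtain xs ys where "\<And>n. xs n \<in> Q" "xs \<longlonglongrightarrow> x" "\<And>n. ys n \<in> Q" "ys \<longlonglongrightarrow> y"
      unfolding closure_sequential by blast
    moreover have "a + b \<in> Q" if "a \<in> Q" "b \<in> Q" for a b
    proof -
      from that obtain l m where "a = ?comb l" "b = ?comb m" by (auto simp: Q_def)
      then have "a + b = ?comb (l @ m)" by simp
      then show ?thesis unfolding Q_def by blast
    qed
    ultimately show "x + y \<in> closure Q"
      unfolding closure_sequential by (intro exI[of _ "\<lambda>n. xs n + ys n"]) (auto intro: tendsto_add)
  next
    fix t :: real and x assume x: "x \<in> closure Q"
    have rat: "real_of_rat c *\<^sub>R q \<in> Q" if "q \<in> Q" for c q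
    proof -
      from that obtain l where "q = ?comb l" by (auto simp: Q_def)
      moreover have "real_of_rat c *\<^sub>R ?comb l = ?comb (map (\<lambda>(d, i). (c * d, i)) l)"
        by (induction l) (auto simp: scaleR_add_right of_rat_mult)
      ultimately show ?thesis unfolding Q_def by (metis rangeI)
    qed
    have real: "t *\<^sub>R q \<in> closure Q" if "q \<in> Q" for q
    proof -
      have "(\<lambda>r. r *\<^sub>R q) ` closure \<rat> \<subseteq> closure Q"
        by (rule image_closure_subset)
          (use rat that closure_subset in \<open>auto intro!: continuous_intros elim!: Rats_cases\<close>)
      then show ?thesis by (auto simp: Rats_closure_real)
    qed
    have "(*\<^sub>R) t ` closure Q \<subseteq> closure Q"
      by (rule image_closure_subset) (use real in \<open>auto intro!: continuous_intros\<close>)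
    then show "t *\<^sub>R x \<in> closure Q" using x by blast
  qed
  moreover have "countable Q" unfolding Q_def by simp
  ultimately show thesis using that by blast
qed

text \<open>The upper limit \<open>f \<mapsto> limsup f (s n)\<close> is sublinear on the dual
  space. A linear functional below it that touches it at \<open>g\<close> is bounded, hence an
  element of the bidual, and by reflexivity it is evaluation at a point \<open>x\<close>. Both
  conclusions say this without mentioning the upper limit: \<open>f x \<le> limsup f (s
  n)\<close> for all \<open>f\<close>, with equality for \<open>g\<close>.\<close>

lemma reflexive_limsup_representation:
  fixes s :: "nat \<Rightarrow> 'a::real_normed_vector" and g :: "'a \<Rightarrow>\<^sub>L real"
  assumes reflexive: "reflexive_space TYPE('a)" and bound: "\<And>n. norm (s n) \<le> B"
  obtains x where
    "\<And>(f :: 'a \<Rightarrow>\<^sub>L real) a. (\<forall>\<^sub>F n in sequentially. f (s n) \<le> a) \<Longrightarrow> f x \<le> a"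
    "\<And>a. a > g x \<Longrightarrow> \<forall>\<^sub>F n in sequentially. g (s n) \<le> a"
proof -
  have B: "0 \<le> B" using bound[of 0] norm_ge_zero[of "s 0"] by linarith
  define U where "U f = {a. \<forall>\<^sub>F n in sequentially. blinfun_apply f (s n) \<le> a}" for f :: "'a \<Rightarrow>\<^sub>L real"
  define p where "p f = Inf (U f)" for f :: "'a \<Rightarrow>\<^sub>L real"
  have abs: "\<bar>blinfun_apply f (s n)\<bar> \<le> B * norm f" for f n
    using norm_blinfun[of f "s n"] mult_left_mono[OF bound[of n] norm_ge_zero[of f]]
    by (simp add: mult.commute)
  have in_U: "B * norm f \<in> U f" for f
    using abs[of f] by (auto simp: U_def abs_le_iff intro: eventuallyI)
  have lower: "- (B * norm f) \<le> a" if "a \<in> U f" for f a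
  proof -
    have "\<exists>n. f (s n) \<le> a"
      by (rule eventually_happens'[OF sequentially_bot]) (use that in \<open>simp add: U_def\<close>)
    then obtain n where "f (s n) \<le> a" ..
    then show ?thesis using abs[of f n] by linarith
  qed
  have p_le: "p f \<le> a" if "a \<in> U f" for f a
    unfolding p_def by (rule cInf_lower[OF that]) (use lower in \<open>auto intro!: bdd_belowI\<close>)
  have p_ge: "m \<le> p f" if "\<And>a. a \<in> U f \<Longrightarrow> m \<le> a" for m f
    unfolding p_def by (rule cInf_greatest) (use in_U that in blast)+
  have "sublinear p"
  proof (rule sublinearI)
    fix f h
    have le: "p (f + h) \<le> a + b" if "a \<in> U f" "b \<in> U h" for a b
    proof (rule p_le)
      show "a + b \<in> U (f + h)"
        using that unfolding U_def mem_Collect_eq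
        by eventually_elim (simp add: blinfun.add_left)
    qed
    have "p (f + h) - p f \<le> b" if "b \<in> U h" for b
    proof -
      have "p (f + h) - b \<le> p f" by (rule p_ge) (use le that in force)
      then show ?thesis by simp
    qed
    then have "p (f + h) - p f \<le> p h" by (rule p_ge)
    then show "p (f + h) \<le> p f + p h" by simp
  next
    have "p 0 \<le> 0" using p_le[OF in_U[of 0]] by simp
    moreover have "0 \<le> p 0" by (rule p_ge) (use lower[of _ 0] in simp)
    ultimately show "p 0 = 0" by simp
  next
    fix t :: real and f assume "t > 0"
    have "p (t *\<^sub>R f) / t \<le> p f"
    proof (rule p_ge)
      fix a assume "a \<in> U f"
      then have "t * a \<in> U (t *\<^sub>R f)"
        unfolding U_def mem_Collect_eq
        by eventually_elim (use \<open>t > 0\<close> in \<open>simp add: blinfun.scaleR_left\<close>)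
      from p_le[OF this] show "p (t *\<^sub>R f) / t \<le> a"
        using \<open>t > 0\<close> by (simp add: field_simps)
    qed
    then show "p (t *\<^sub>R f) \<le> t * p f"
      using \<open>t > 0\<close> by (simp add: field_simps)
  qed
  then obtain \<phi> where \<phi>: "linear \<phi>" "\<And>f. \<phi> f \<le> p f" "\<phi> g = p g"
    using hahn_banach_touching[where z = g] by metis
  have "\<phi> f \<le> B * norm f" for f
    using \<phi>(2)[of f] p_le[OF in_U[of f]] by linarith
  then obtain \<psi> :: "('a \<Rightarrow>\<^sub>L real) \<Rightarrow>\<^sub>L real" where \<psi>: "blinfun_apply \<psi> = \<phi>"
    using dominated_functional_bounded[OF \<phi>(1) _ B] by metis
  obtain x where x: "\<And>f. \<phi> f = blinfun_apply f x"
    using reflexive \<psi> unfolding reflexive_space_def by metis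
  have 1: "blinfun_apply f x \<le> a" if "\<forall>\<^sub>F n in sequentially. f (s n) \<le> a"
    for f :: "'a \<Rightarrow>\<^sub>L real" and a
    using p_le[of a f] \<phi>(2)[of f] that by (simp add: U_def x)
  have 2: "\<forall>\<^sub>F n in sequentially. g (s n) \<le> a" if "a > g x" for a
  proof -
    from that have "Inf (U g) < a" using \<phi>(3) by (simp add: x p_def)
    then obtain b where "b \<in> U g" "b < a"
      using in_U cInf_lessD by (metis empty_iff)
    then show ?thesis unfolding U_def by (auto elim: eventually_mono)
  qed
  from 1 2 that show thesis by blast
qed

text \<open>Norming functionals of a countable dense subset \<open>Q\<close> of the closed span
  of the sequence separate the points of that span. By a diagonal argument their values all
  converge along one subsequence. The points \<open>X g\<close> representing the upper limits of
  the subsequence lie in the closed span, and the separating functionals take the same values at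
  all of them, namely their limits; so all \<open>X g\<close> coincide. Comparing
  \<open>g\<close> with \<open>- g\<close> then shows that upper and lower limit of
  \<open>g\<close> agree.\<close>

theorem reflexive_bounded_weakly_convergent_subsequence:
  fixes s :: "nat \<Rightarrow> 'a::real_normed_vector"
  assumes reflexive: "reflexive_space TYPE('a)" and bound: "\<And>n. norm (s n) \<le> B"
  obtains r u where "strict_mono r" "weakly_converges (s \<circ> r) u"
proof -
  obtain Q where Q: "countable Q" "range s \<subseteq> closure Q" "subspace (closure Q)"
    by (rule separable_closed_span)
  have "\<forall>q. \<exists>f :: 'a \<Rightarrow>\<^sub>L real. norm f \<le> 1 \<and> blinfun_apply f q = norm q"
    using norming_functional by metis
  then obtain D :: "'a \<Rightarrow> 'a \<Rightarrow>\<^sub>L real" where D: "\<And>q. norm (D q) \<le> 1" "\<And>q. D q q = norm q"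
    by metis
  have D_le: "\<bar>D q x\<bar> \<le> norm x" for q x
    using norm_blinfun[of "D q" x] mult_right_mono[OF D(1)[of q] norm_ge_zero[of x]] by simp
  have separates: "z = 0" if "z \<in> closure Q" "\<And>q. q \<in> Q \<Longrightarrow> D q z = 0" for z
  proof (rule ccontr)
    assume "z \<noteq> 0"
    then obtain q where q: "q \<in> Q" "dist q z < norm z / 3"
      using \<open>z \<in> closure Q\<close> closure_approachable[of z Q]
      by (metis divide_pos_pos zero_less_norm_iff zero_less_numeral)
    (* D q attains the norm of q but vanishes at z. *)
    have "norm q \<le> norm (q - z)"
      using D_le[of q "q - z"] D(2)[of q] that(2)[OF q(1)] by (simp add: blinfun.diff_right)
    moreover have "norm z \<le> norm q + norm (q - z)"
      using norm_triangle_ineq4[of q "q - z"] by simp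
    ultimately show False using q(2) norm_ge_zero[of "q - z"] unfolding dist_norm by linarith
  qed
  have D_bound: "norm (D q (s n)) \<le> B" for q n
    using D_le[of q "s n"] bound[of n] by simp
  obtain r where r: "strict_mono (r :: nat \<Rightarrow> nat)"
    and conv: "\<And>q. q \<in> Q \<Longrightarrow> \<exists>l. (\<lambda>n. D q (s (r n))) \<longlonglongrightarrow> l"
    using D_bound by (rule function_convergent_subsequence[OF Q(1), of "\<lambda>n q. D q (s n)" B]) blast
  define dominated where "dominated x \<longleftrightarrow>
      (\<forall>(f :: 'a \<Rightarrow>\<^sub>L real) a. (\<forall>\<^sub>F n in sequentially. f (s (r n)) \<le> a) \<longrightarrow> f x \<le> a)" for x
  have "\<exists>x. dominated x \<and> (\<forall>a > g x. \<forall>\<^sub>F n in sequentially. g (s (r n)) \<le> a)"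
    for g :: "'a \<Rightarrow>\<^sub>L real"
  proof -
    obtain x where
      "\<And>(f :: 'a \<Rightarrow>\<^sub>L real) a. (\<forall>\<^sub>F n in sequentially. f (s (r n)) \<le> a) \<Longrightarrow> f x \<le> a"
      "\<And>a. a > g x \<Longrightarrow> \<forall>\<^sub>F n in sequentially. g (s (r n)) \<le> a"
      using reflexive_limsup_representation[OF reflexive, of "\<lambda>n. s (r n)" B g] bound by blast
    then show ?thesis unfolding dominated_def by blast
  qed
  then have "\<forall>g :: 'a \<Rightarrow>\<^sub>L real. \<exists>x. dominated x \<and>
      (\<forall>a > g x. \<forall>\<^sub>F n in sequentially. g (s (r n)) \<le> a)"
    by blast
  from choice[OF this] obtain X where X: "\<And>g :: 'a \<Rightarrow>\<^sub>L real. dominated (X g)"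
    and limsup: "\<And>(g :: 'a \<Rightarrow>\<^sub>L real) a. a > g (X g) \<Longrightarrow> \<forall>\<^sub>F n in sequentially. g (s (r n)) \<le> a"
    by blast
  have in_closure: "x \<in> closure Q" if "dominated x" for x
  proof (rule ccontr)
    assume "x \<notin> closure Q"
    then obtain f :: "'a \<Rightarrow>\<^sub>L real" where f: "\<And>y. y \<in> closure Q \<Longrightarrow> f y = 0" "f x > 0"
      using separating_functional[OF Q(3)] by (metis closure_closure)
    have "f (s (r n)) \<le> 0" for n using f(1) Q(2) by (simp add: subset_iff)
    then have "f x \<le> 0" using that unfolding dominated_def by simp
    with f(2) show False by simp
  qed
  have limit: "D q x = l" if "dominated x" "(\<lambda>n. D q (s (r n))) \<longlonglongrightarrow> l" for q x l
  proof (rule antisym)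
    show "D q x \<le> l"
    proof (rule field_le_epsilon)
      fix e :: real assume "e > 0"
      then have "\<forall>\<^sub>F n in sequentially. D q (s (r n)) \<le> l + e"
        using order_tendstoD(2)[OF that(2), of "l + e"] by (auto elim: eventually_mono)
      then show "D q x \<le> l + e" using that(1) unfolding dominated_def by blast
    qed
    show "l \<le> D q x"
    proof (rule field_le_epsilon)
      fix e :: real assume "e > 0"
      then have "\<forall>\<^sub>F n in sequentially. (- D q) (s (r n)) \<le> - l + e"
        using order_tendstoD(1)[OF that(2), of "l - e"]
        by (auto elim: eventually_mono simp: blinfun.minus_left)
      then have "(- D q) x \<le> - l + e" using that(1) unfolding dominated_def by blast
      then show "l \<le> D q x + e" by (simp add: blinfun.minus_left)
    qed
  qed
  have unique: "x = y" if "dominated x" "dominated y" for x y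
  proof -
    have "D q (x - y) = 0" if "q \<in> Q" for q
      using conv[OF that] limit \<open>dominated x\<close> \<open>dominated y\<close> by (auto simp: blinfun.diff_right)
    then have "x - y = 0"
      using subspace_diff[OF Q(3)] in_closure that by (intro separates) auto
    then show ?thesis by simp
  qed
  define u where "u = X 0"
  have u: "X g = u" for g :: "'a \<Rightarrow>\<^sub>L real" using unique X by (simp add: u_def)
  have "(\<lambda>n. g (s (r n))) \<longlonglongrightarrow> g u" for g :: "'a \<Rightarrow>\<^sub>L real"
  proof (rule order_tendstoI)
    fix a assume "a < g u"
    then obtain b where b: "a < b" "b < g u" using dense by blast
    then have "\<forall>\<^sub>F n in sequentially. (- g) (s (r n)) \<le> - b"
      using limsup[of "- g" "- b"] by (simp add: u blinfun.minus_left)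
    then show "\<forall>\<^sub>F n in sequentially. a < g (s (r n))"
      by eventually_elim (use b in \<open>simp add: blinfun.minus_left\<close>)
  next
    fix a assume "g u < a"
    then obtain b where b: "g u < b" "b < a" using dense by blast
    then have "\<forall>\<^sub>F n in sequentially. g (s (r n)) \<le> b"
      using limsup[of g b] by (simp add: u)
    then show "\<forall>\<^sub>F n in sequentially. g (s (r n)) < a"
      by eventually_elim (use b in simp)
  qed
  then have "weakly_converges (s \<circ> r) u" by (simp add: weakly_converges_iff)
  with r that show thesis by blast
qed

section \<open>Functionals along weakly convergent sequences\<close>

lemma weakly_converges_scaleR:
  assumes "weakly_converges s u"
  shows "weakly_converges (\<lambda>n. t *\<^sub>R s n) (t *\<^sub>R u)"
  using assms by (auto simp: weakly_converges_iff blinfun.scaleR_right intro!: tendsto_mult_left)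

lemma weakly_lsc_le_limit:
  assumes "weakly_lsc F" "weakly_converges s u" "\<And>n. F (s n) \<le> a n" "a \<longlonglongrightarrow> A"
  shows "F u \<le> A"
proof -
  have "ereal (F u) \<le> liminf (\<lambda>n. ereal (F (s n)))"
    using assms(1,2) unfolding weakly_lsc_def by blast
  also have "\<dots> \<le> liminf (\<lambda>n. ereal (a n))"
    by (intro Liminf_mono always_eventually) (simp add: assms(3))
  also have "\<dots> = ereal A"
    using assms(4) by (intro lim_imp_Liminf) auto
  finally show ?thesis by simp
qed

text \<open>The differences \<open>T n - L\<close> tend to \<open>0\<close> in norm and act on a
  bounded sequence, so only the fixed functional \<open>L\<close> counts in the limit.\<close>

lemma weak_limit_of_pairing:
  fixes s :: "nat \<Rightarrow> 'a::real_normed_vector" and T :: "nat \<Rightarrow> 'a \<Rightarrow>\<^sub>L real"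
  assumes s: "weakly_converges s u" and bound: "\<And>n. norm (s n) \<le> B" and T: "T \<longlonglongrightarrow> L"
  shows "(\<lambda>n. T n (s n)) \<longlonglongrightarrow> L u"
proof -
  have "(\<lambda>n. (T n - L) (s n)) \<longlonglongrightarrow> 0"
  proof (rule Lim_null_comparison)
    show "\<forall>\<^sub>F n in sequentially. norm ((T n - L) (s n)) \<le> norm (T n - L) * B"
      by (intro always_eventually allI order_trans[OF norm_blinfun] mult_left_mono bound) simp
    have "(\<lambda>n. norm (T n - L) * B) \<longlonglongrightarrow> norm (L - L) * B"
      by (intro tendsto_intros T)
    then show "(\<lambda>n. norm (T n - L) * B) \<longlonglongrightarrow> 0" by simp
  qed
  moreover have "(\<lambda>n. L (s n)) \<longlonglongrightarrow> L u"
    using s by (simp add: weakly_converges_iff)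
  ultimately have "(\<lambda>n. (T n - L) (s n) + L (s n)) \<longlonglongrightarrow> 0 + L u"
    by (rule tendsto_add)
  then show ?thesis by (simp add: blinfun.diff_left)
qed

lemma C1_functional_line_derivative:
  assumes "C1_functional F F'"
  shows "((\<lambda>t. F (u + t *\<^sub>R v)) has_real_derivative F' (u + t *\<^sub>R v) v) (at t)"
proof -
  have "(F has_derivative blinfun_apply (F' (u + t *\<^sub>R v))) (at (u + t *\<^sub>R v))"
    using assms by (simp add: C1_functional_def)
  then have "((\<lambda>t. F (u + t *\<^sub>R v)) has_derivative (\<lambda>h. F' (u + t *\<^sub>R v) (h *\<^sub>R v))) (at t)"
    by (rule has_derivative_compose[rotated]) (auto intro!: derivative_eq_intros)
  then show ?thesis
    by (simp add: has_field_derivative_def blinfun.scaleR_right mult.commute[of _ "F' (u + t *\<^sub>R v) v"])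
qed

text \<open>By the mean value theorem \<open>F (s n) - F u\<close> is the derivative at an
  intermediate point applied to \<open>s n - u\<close>. The intermediate points again converge
  weakly to \<open>u\<close>, so these derivatives converge in norm while \<open>s n - u\<close>
  tends weakly to \<open>0\<close>.\<close>

lemma C1_functional_weakly_continuous:
  fixes F :: "'a::real_normed_vector \<Rightarrow> real"
  assumes C1: "C1_functional F F'" and cc: "completely_continuous F'"
    and s: "weakly_converges s u" and bound: "\<And>n. norm (s n) \<le> B"
  shows "(\<lambda>n. F (s n)) \<longlonglongrightarrow> F u"
proof -
  have "\<exists>\<theta>. 0 < \<theta> \<and> \<theta> < 1 \<and> F (s n) - F u = F' (u + \<theta> *\<^sub>R (s n - u)) (s n - u)" for n
    using MVT2[of 0 1 "\<lambda>t. F (u + t *\<^sub>R (s n - u))" "\<lambda>t. F' (u + t *\<^sub>R (s n - u)) (s n - u)"]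
      C1_functional_line_derivative[OF C1]
    by auto
  then obtain \<theta> where \<theta>: "\<And>n. 0 < \<theta> n" "\<And>n. \<theta> n < 1"
    "\<And>n. F (s n) - F u = F' (u + \<theta> n *\<^sub>R (s n - u)) (s n - u)"
    by metis
  have diff: "(\<lambda>n. f (s n - u)) \<longlonglongrightarrow> 0" for f :: "'a \<Rightarrow>\<^sub>L real"
    using s LIM_zero by (auto simp: weakly_converges_iff blinfun.diff_right)
  have "weakly_converges (\<lambda>n. u + \<theta> n *\<^sub>R (s n - u)) u"
    unfolding weakly_converges_iff
  proof
    fix f :: "'a \<Rightarrow>\<^sub>L real"
    have "(\<lambda>n. \<theta> n * f (s n - u)) \<longlonglongrightarrow> 0"
      by (rule Lim_null_comparison[OF _ tendsto_rabs_zero[OF diff[of f]]])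
        (use \<theta>(1,2) in \<open>auto intro!: always_eventually mult_left_le_one_le simp: abs_mult less_imp_le\<close>)
    then have "(\<lambda>n. f u + \<theta> n * f (s n - u)) \<longlonglongrightarrow> f u + 0"
      by (intro tendsto_add tendsto_const)
    then show "(\<lambda>n. f (u + \<theta> n *\<^sub>R (s n - u))) \<longlonglongrightarrow> f u"
      by (simp add: blinfun.add_right blinfun.scaleR_right)
  qed
  then have F': "(\<lambda>n. F' (u + \<theta> n *\<^sub>R (s n - u))) \<longlonglongrightarrow> F' u"
    using cc unfolding completely_continuous_def by blast
  have "(\<lambda>n. F' (u + \<theta> n *\<^sub>R (s n - u)) (s n - u)) \<longlonglongrightarrow> F' u 0"
  proof (rule weak_limit_of_pairing[OF _ _ F'])
    show "weakly_converges (\<lambda>n. s n - u) 0"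
      by (simp add: weakly_converges_iff diff)
    show "norm (s n - u) \<le> B + norm u" for n
      using norm_triangle_ineq4[of "s n" u] bound[of n] by linarith
  qed
  then have "(\<lambda>n. F (s n) - F u) \<longlonglongrightarrow> 0" by (simp add: \<theta>(3))
  then show ?thesis by (rule LIM_zero_cancel)
qed

section \<open>Fibering along rays\<close>

text \<open>The behaviour of a functional along rays that the Nehari method uses, isolated from
  the growth conditions that produce it. Single crossing is what remains of a strictly
  decreasing weighted slope once the positive weight is forgotten.\<close>

locale nehari_fibering =
  fixes \<Phi> :: "'a::real_normed_vector \<Rightarrow> real" and \<Phi>' :: "'a \<Rightarrow> 'a \<Rightarrow>\<^sub>L real" and Y :: "'a set"
  assumes \<Phi>_C1: "C1_functional \<Phi> \<Phi>'" and \<Phi>_zero: "\<Phi> 0 = 0" and cone: "open_cone Y"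
    and single_crossing:
      "\<And>u s t. u \<in> Y \<Longrightarrow> 0 < s \<Longrightarrow> s < t \<Longrightarrow> \<Phi>' (s *\<^sub>R u) u \<le> 0 \<Longrightarrow> \<Phi>' (t *\<^sub>R u) u < 0"
    and initially_increasing: "\<And>u. u \<in> Y \<Longrightarrow> \<exists>s>0. \<Phi>' (s *\<^sub>R u) u > 0"
    and eventually_nonpositive: "\<And>u. u \<in> Y \<Longrightarrow> \<exists>t>0. \<Phi> (t *\<^sub>R u) \<le> 0"
begin

lemma scale_in_cone: "t > 0 \<Longrightarrow> u \<in> Y \<Longrightarrow> t *\<^sub>R u \<in> Y"
  using cone by (simp add: open_cone_def)

lemma ray_derivative: "((\<lambda>t. \<Phi> (t *\<^sub>R u)) has_real_derivative \<Phi>' (t *\<^sub>R u) u) (at t)"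
  using C1_functional_line_derivative[OF \<Phi>_C1, of 0 u t] by simp

lemma ray_continuous: "continuous_on S (\<lambda>t. \<Phi> (t *\<^sub>R u))"
  by (intro continuous_at_imp_continuous_on ballI DERIV_isCont[OF ray_derivative])

lemma derivative_continuous:
  assumes "continuous_on S f" "continuous_on S g"
  shows "continuous_on S (\<lambda>x. \<Phi>' (f x) (g x))"
proof -
  have "continuous_on S (\<lambda>x. \<Phi>' (f x))"
    using \<Phi>_C1 assms(1) unfolding C1_functional_def
    by (auto intro: continuous_on_compose2[of UNIV \<Phi>'])
  then show ?thesis using assms(2) by (intro continuous_intros)
qed

lemma nehari_set_iff: "u \<in> Y \<Longrightarrow> u \<in> nehari_set \<Phi> \<longleftrightarrow> \<Phi>' u u = 0"
proof -
  assume "u \<in> Y"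
  then have "u \<noteq> 0" using cone by (auto simp: open_cone_def)
  moreover have "frechet_derivative \<Phi> (at u) = \<Phi>' u"
    using \<Phi>_C1 by (intro frechet_derivative_at[symmetric]) (simp add: C1_functional_def)
  ultimately show ?thesis by (simp add: nehari_set_def)
qed

lemma increasing_before_crossing:
  assumes u: "u \<in> Y" and "0 \<le> s" "s < t" "0 \<le> \<Phi>' (t *\<^sub>R u) u"
  shows "\<Phi> (s *\<^sub>R u) < \<Phi> (t *\<^sub>R u)"
proof (rule DERIV_pos_imp_increasing_open[OF \<open>s < t\<close> _ ray_continuous])
  fix r assume "s < r" "r < t"
  then have "0 < \<Phi>' (r *\<^sub>R u) u"
    using single_crossing[OF u, of r t] assms by force
  then show "\<exists>y. ((\<lambda>t. \<Phi> (t *\<^sub>R u)) has_real_derivative y) (at r) \<and> 0 < y"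
    using ray_derivative by blast
qed

lemma decreasing_after_crossing:
  assumes u: "u \<in> Y" and "0 < s" "s < t" "\<Phi>' (s *\<^sub>R u) u \<le> 0"
  shows "\<Phi> (t *\<^sub>R u) < \<Phi> (s *\<^sub>R u)"
proof (rule DERIV_neg_imp_decreasing_open[OF \<open>s < t\<close> _ ray_continuous])
  fix r assume "s < r" "r < t"
  then have "\<Phi>' (r *\<^sub>R u) u < 0"
    using single_crossing[OF u, of s r] assms by force
  then show "\<exists>y. ((\<lambda>t. \<Phi> (t *\<^sub>R u)) has_real_derivative y) (at r) \<and> y < 0"
    using ray_derivative by blast
qed

lemma nehari_maximizes_on_ray:
  assumes "u \<in> Y" "u \<in> nehari_set \<Phi>" "0 \<le> t"
  shows "\<Phi> (t *\<^sub>R u) \<le> \<Phi> u"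
  using increasing_before_crossing[of u t 1] decreasing_after_crossing[of u 1 t] assms
  by (cases t "1::real" rule: linorder_cases) (auto simp: nehari_set_iff)

lemma nehari_positive:
  assumes "u \<in> Y" "u \<in> nehari_set \<Phi>"
  shows "0 < \<Phi> u"
  using increasing_before_crossing[of u 0 1] assms by (auto simp: nehari_set_iff \<Phi>_zero)

lemma ray_meets_nehari_set:
  assumes u: "u \<in> Y"
  obtains t where "t > 0" "t *\<^sub>R u \<in> nehari_set \<Phi>"
proof -
  obtain s where s: "s > 0" "\<Phi>' (s *\<^sub>R u) u > 0" using initially_increasing[OF u] by blast
  obtain t where t: "t > 0" "\<Phi> (t *\<^sub>R u) \<le> 0" using eventually_nonpositive[OF u] by blast
  have neg: "\<Phi>' (t *\<^sub>R u) u < 0"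
    using increasing_before_crossing[OF u, of 0 t] t \<Phi>_zero by force
  have "s < t"
    using single_crossing[OF u \<open>t > 0\<close>, of s] neg s by (cases s t rule: linorder_cases) auto
  have "continuous_on {s..t} (\<lambda>r. \<Phi>' (r *\<^sub>R u) u)"
    by (intro derivative_continuous continuous_intros)
  then obtain r where r: "s \<le> r" "\<Phi>' (r *\<^sub>R u) u = 0"
    using IVT2'[of "\<lambda>r. \<Phi>' (r *\<^sub>R u) u" t 0 s] neg s \<open>s < t\<close> by auto
  with s have "r > 0" by simp
  then have "r *\<^sub>R u \<in> nehari_set \<Phi>"
    using r by (simp add: nehari_set_iff scale_in_cone u blinfun.scaleR_right)
  with \<open>r > 0\<close> that show thesis by blast
qed

text \<open>If \<open>w\<close> were not critical, some direction \<open>v\<close> would be a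
  descent direction near \<open>w\<close>. For small \<open>s > 0\<close> the slope along the
  ray of \<open>w + s v\<close> still changes sign near \<open>t = 1\<close>, so there is a
  Nehari point \<open>t (w + s v)\<close> with \<open>t\<close> near \<open>1\<close>. Descent
  makes its value smaller than \<open>\<Phi> (t w)\<close>, which is at most \<open>\<Phi>
  w\<close> because \<open>w\<close> maximizes \<open>\<Phi>\<close> on its ray. Only the
  continuity of \<open>\<Phi>'\<close> enters, not any smoothness of the Nehari set.\<close>

theorem nehari_minimizer_critical:
  assumes w: "w \<in> Y" "w \<in> nehari_set \<Phi>"
    and min: "\<And>z. z \<in> Y \<Longrightarrow> z \<in> nehari_set \<Phi> \<Longrightarrow> \<Phi> w \<le> \<Phi> z"
  shows "critical_point \<Phi> w"
proof -
  have "\<Phi>' w v = 0" for v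
  proof (rule ccontr)
    assume "\<Phi>' w v \<noteq> 0"
    then obtain v where v: "\<Phi>' w v < 0"
      by (metis blinfun.minus_right neg_less_0_iff_less not_less_iff_gr_or_eq)
    define W where "W = {p :: real \<times> real. \<Phi>' (fst p *\<^sub>R (w + snd p *\<^sub>R v)) v < 0}"
    have "open W"
      unfolding W_def by (intro open_Collect_less derivative_continuous continuous_intros)
    moreover have "(1, 0) \<in> W" using v by (simp add: W_def)
    ultimately obtain A B where "open A" "open B" "1 \<in> A" "0 \<in> B" "A \<times> B \<subseteq> W"
      by (auto elim: open_prod_elim)
    then obtain \<alpha> \<beta> where \<alpha>: "\<alpha> > 0" "ball 1 \<alpha> \<subseteq> A" and \<beta>: "\<beta> > 0" "ball 0 \<beta> \<subseteq> B"
      by (meson openE)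
    (* Small enough for descent, and below 1 so that 1 - \<delta> is a point of the open ray. *)
    define \<delta> where "\<delta> = min \<alpha> 1 / 2"
    have \<delta>: "0 < \<delta>" "\<delta> < 1" "\<delta> < \<alpha>" using \<alpha> by (auto simp: \<delta>_def min_def)
    have descent: "\<Phi>' (t *\<^sub>R (w + r *\<^sub>R v)) v < 0" if "\<bar>t - 1\<bar> \<le> \<delta>" "\<bar>r\<bar> < \<beta>" for t r
    proof -
      have "t \<in> ball 1 \<alpha>" "r \<in> ball 0 \<beta>" using that \<delta> by (auto simp: dist_real_def)
      then have "(t, r) \<in> W" using \<alpha> \<beta> \<open>A \<times> B \<subseteq> W\<close> by blast
      then show ?thesis by (simp add: W_def)
    qed
    have zero_at_1: "\<Phi>' (1 *\<^sub>R w) w = 0" using w by (simp add: nehari_set_iff)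
    have before: "0 < \<Phi>' ((1 - \<delta>) *\<^sub>R w) w"
      using single_crossing[OF w(1), of "1 - \<delta>" 1] zero_at_1 \<delta> by force
    have after: "\<Phi>' ((1 + \<delta>) *\<^sub>R w) w < 0"
      using single_crossing[OF w(1), of 1 "1 + \<delta>"] zero_at_1 \<delta> by force
    have line: "((\<lambda>s. w + s *\<^sub>R v) \<longlongrightarrow> w + 0 *\<^sub>R v) (at_right 0)"
      by (intro tendsto_intros)
    have slope: "((\<lambda>s. \<Phi>' (t *\<^sub>R (w + s *\<^sub>R v)) (w + s *\<^sub>R v)) \<longlongrightarrow> \<Phi>' (t *\<^sub>R w) w) (at_right 0)" for t
    proof -
      have "continuous_on UNIV (\<lambda>s. \<Phi>' (t *\<^sub>R (w + s *\<^sub>R v)) (w + s *\<^sub>R v))"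
        by (intro derivative_continuous continuous_intros)
      then have "isCont (\<lambda>s. \<Phi>' (t *\<^sub>R (w + s *\<^sub>R v)) (w + s *\<^sub>R v)) 0"
        by (simp add: continuous_on_eq_continuous_at)
      then show ?thesis
        unfolding isCont_def by (auto intro: filterlim_at_split[THEN iffD1, THEN conjunct2])
    qed
    have "\<forall>\<^sub>F s in at_right 0. w + s *\<^sub>R v \<in> Y"
      using topological_tendstoD[OF line] cone w(1) by (simp add: open_cone_def)
    moreover have "\<forall>\<^sub>F s in at_right 0. s \<in> {0<..<\<beta>}"
      by (rule eventually_at_right_real) (rule \<beta>(1))
    moreover have "\<forall>\<^sub>F s in at_right 0. 0 < \<Phi>' ((1 - \<delta>) *\<^sub>R (w + s *\<^sub>R v)) (w + s *\<^sub>R v)"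
      by (rule order_tendstoD(1)[OF slope before])
    moreover have "\<forall>\<^sub>F s in at_right 0. \<Phi>' ((1 + \<delta>) *\<^sub>R (w + s *\<^sub>R v)) (w + s *\<^sub>R v) < 0"
      by (rule order_tendstoD(2)[OF slope after])
    ultimately have "\<forall>\<^sub>F s in at_right 0. w + s *\<^sub>R v \<in> Y \<and> 0 < s \<and> s < \<beta> \<and>
        0 < \<Phi>' ((1 - \<delta>) *\<^sub>R (w + s *\<^sub>R v)) (w + s *\<^sub>R v) \<and>
        \<Phi>' ((1 + \<delta>) *\<^sub>R (w + s *\<^sub>R v)) (w + s *\<^sub>R v) < 0"
      by eventually_elim simp
    then obtain s where s: "w + s *\<^sub>R v \<in> Y" "0 < s" "s < \<beta>"
      "0 < \<Phi>' ((1 - \<delta>) *\<^sub>R (w + s *\<^sub>R v)) (w + s *\<^sub>R v)"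
      "\<Phi>' ((1 + \<delta>) *\<^sub>R (w + s *\<^sub>R v)) (w + s *\<^sub>R v) < 0"
      using eventually_happens'[OF trivial_limit_at_right_real] by blast
    have "continuous_on {1 - \<delta>..1 + \<delta>} (\<lambda>t. \<Phi>' (t *\<^sub>R (w + s *\<^sub>R v)) (w + s *\<^sub>R v))"
      by (intro derivative_continuous continuous_intros)
    then obtain t where t: "1 - \<delta> \<le> t" "t \<le> 1 + \<delta>" "\<Phi>' (t *\<^sub>R (w + s *\<^sub>R v)) (w + s *\<^sub>R v) = 0"
      using IVT2'[of "\<lambda>t. \<Phi>' (t *\<^sub>R (w + s *\<^sub>R v)) (w + s *\<^sub>R v)" "1 + \<delta>" 0 "1 - \<delta>"] s(4,5) \<delta>
      by auto
    have "t > 0" using t \<delta> by simp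
    have z: "t *\<^sub>R (w + s *\<^sub>R v) \<in> Y" using \<open>t > 0\<close> s(1) by (rule scale_in_cone)
    moreover have "t *\<^sub>R (w + s *\<^sub>R v) \<in> nehari_set \<Phi>"
      using t(3) by (simp only: nehari_set_iff[OF z] blinfun.scaleR_right) simp
    ultimately have "\<Phi> w \<le> \<Phi> (t *\<^sub>R (w + s *\<^sub>R v))" by (rule min)
    also have "\<Phi> (t *\<^sub>R (w + s *\<^sub>R v)) < \<Phi> (t *\<^sub>R (w + 0 *\<^sub>R v))"
    proof (rule DERIV_neg_imp_decreasing[OF \<open>0 < s\<close>])
      fix r assume r: "0 \<le> r" "r \<le> s"
      have "((\<lambda>r. \<Phi> (t *\<^sub>R (w + r *\<^sub>R v))) has_real_derivative t * \<Phi>' (t *\<^sub>R (w + r *\<^sub>R v)) v) (at r)"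
        using C1_functional_line_derivative[OF \<Phi>_C1, of "t *\<^sub>R w" "t *\<^sub>R v" r]
        by (simp add: scaleR_add_right blinfun.scaleR_right mult.commute)
      moreover have "t * \<Phi>' (t *\<^sub>R (w + r *\<^sub>R v)) v < 0"
        using descent[of t r] t r s(3) \<open>t > 0\<close> by (simp add: mult_pos_neg)
      ultimately show "\<exists>y. ((\<lambda>r. \<Phi> (t *\<^sub>R (w + r *\<^sub>R v))) has_real_derivative y) (at r) \<and> y < 0"
        by blast
    qed
    also have "\<Phi> (t *\<^sub>R (w + 0 *\<^sub>R v)) \<le> \<Phi> w"
      using nehari_maximizes_on_ray[OF w, of t] \<open>t > 0\<close> by simp
    finally show False by simp
  qed
  moreover have "(\<Phi> has_derivative blinfun_apply (\<Phi>' w)) (at w)"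
    using \<Phi>_C1 by (simp add: C1_functional_def)
  ultimately show ?thesis
    unfolding critical_point_def by (metis (no_types, lifting) ext)
qed

end

section \<open>The minimization problem\<close>

locale nehari_splitting =
  fixes I0 I :: "'a::real_normed_vector \<Rightarrow> real" and I0' I' :: "'a \<Rightarrow> 'a \<Rightarrow>\<^sub>L real"
    and Y :: "'a set" and C \<eta> \<sigma> :: real
  assumes reflexive: "reflexive_space TYPE('a)"
    and cone: "open_cone Y"
    and I0_C1: "C1_functional I0 I0'" and I_C1: "C1_functional I I'"
    and I0_zero: "I0 0 = 0" and I_zero: "I 0 = 0"
    and lsc: "weakly_lsc I0"
    and completely_continuous: "completely_continuous I'"
    and coercive: "C > 0" "\<eta> > 1" "\<And>u. u \<in> Y \<Longrightarrow> C * norm u powr \<eta> \<le> I0' u u"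
    and higher_order: "(\<lambda>u. norm (I' u))
         \<in> o[at 0 within (weak_topology closure_of Y)](\<lambda>u. norm u powr (\<eta> - 1))"
    and frontier: "\<And>u. u \<in> weak_topology frontier_of Y \<Longrightarrow> I u = 0 \<and> I' u u = 0"
    and I0_slope:
      "\<And>u. u \<in> Y \<Longrightarrow> antimono_on {0<..} (\<lambda>t. I0' (t *\<^sub>R u) u / t powr (\<sigma> - 1))"
    and I_slope:
      "\<And>u. u \<in> Y \<Longrightarrow> strict_mono_on {0<..} (\<lambda>t. I' (t *\<^sub>R u) u / t powr (\<sigma> - 1))"
    and I0_growth: "\<And>K. K \<subseteq> Y \<Longrightarrow> compactin weak_topology K \<Longrightarrow>
         \<exists>M. \<forall>\<^sub>F t in at_top. \<forall>u\<in>K. I0 (t *\<^sub>R u) / t powr \<sigma> \<le> M"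
    and I_growth: "\<And>K M. K \<subseteq> Y \<Longrightarrow> compactin weak_topology K \<Longrightarrow>
         \<forall>\<^sub>F t in at_top. \<forall>u\<in>K. I (t *\<^sub>R u) / t powr \<sigma> \<ge> M"
begin

abbreviation \<Phi> :: "'a \<Rightarrow> real" where "\<Phi> \<equiv> \<lambda>u. I0 u - I u"

abbreviation N :: "'a set" where "N \<equiv> nehari_set \<Phi> \<inter> Y"

lemma cone_nonzero: "u \<in> Y \<Longrightarrow> u \<noteq> 0"
  using cone by (auto simp: open_cone_def)

lemma negative_at_infinity:
  assumes "K \<subseteq> Y" "compactin weak_topology K"
  shows "\<forall>\<^sub>F t in at_top. \<forall>u\<in>K. \<Phi> (t *\<^sub>R u) < 0"
proof -
  obtain M where "\<forall>\<^sub>F t in at_top. \<forall>u\<in>K. I0 (t *\<^sub>R u) / t powr \<sigma> \<le> M"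
    using I0_growth[OF assms] by blast
  moreover note I_growth[OF assms, of "M + 1"]
  moreover note eventually_gt_at_top[of "0 :: real"]
  ultimately show ?thesis
  proof eventually_elim
    case (elim t)
    show ?case
    proof
      fix u assume "u \<in> K"
      then have "I0 (t *\<^sub>R u) / t powr \<sigma> < I (t *\<^sub>R u) / t powr \<sigma>" using elim by force
      then show "\<Phi> (t *\<^sub>R u) < 0" using elim by (simp add: divide_less_cancel)
    qed
  qed
qed

text \<open>Along the cone \<open>I' u u\<close> is of smaller order than the coercive bound on
  \<open>I0' u u\<close>. This makes \<open>\<Phi>\<close> increase initially along rays, and
  keeps the Nehari set away from the origin.\<close>

lemma I'_small_near_zero:
  obtains \<rho> where "\<rho> > 0" "\<And>u. u \<in> Y \<Longrightarrow> norm u < \<rho> \<Longrightarrow> I' u u < C * norm u powr \<eta>"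
proof -
  have "\<forall>\<^sub>F u in at 0 within (weak_topology closure_of Y).
      norm (norm (I' u)) \<le> C / 2 * norm (norm u powr (\<eta> - 1))"
    using coercive(1) by (intro landau_o.smallD[OF higher_order]) simp
  then obtain \<rho> where \<rho>: "\<rho> > 0" "\<And>u. u \<in> weak_topology closure_of Y \<Longrightarrow> u \<noteq> 0 \<Longrightarrow> norm u < \<rho> \<Longrightarrow>
      norm (I' u) \<le> C / 2 * norm u powr (\<eta> - 1)"
    unfolding eventually_at by (auto simp: dist_norm)
  have "I' u u < C * norm u powr \<eta>" if "u \<in> Y" "norm u < \<rho>" for u
  proof -
    have "u \<in> weak_topology closure_of Y"
      using that(1) closure_of_subset[of Y weak_topology] by auto
    have "norm u > 0" using cone_nonzero[OF that(1)] by simp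
    have "I' u u \<le> norm (I' u) * norm u" using norm_blinfun[of "I' u" u] by simp
    also have "\<dots> \<le> (C / 2 * norm u powr (\<eta> - 1)) * norm u"
      using \<rho>(2)[of u] that \<open>u \<in> weak_topology closure_of Y\<close> cone_nonzero
      by (intro mult_right_mono) auto
    also have "\<dots> = C / 2 * norm u powr \<eta>"
      using \<open>norm u > 0\<close> by (simp add: powr_diff)
    also have "\<dots> < C * norm u powr \<eta>"
      using \<open>norm u > 0\<close> coercive(1) by simp
    finally show ?thesis .
  qed
  with \<rho>(1) that show thesis by blast
qed

sublocale nehari_fibering \<Phi> "\<lambda>u. I0' u - I' u" Y
proof
  show "C1_functional \<Phi> (\<lambda>u. I0' u - I' u)"
    using I0_C1 I_C1 unfolding C1_functional_def
    by (auto intro!: derivative_eq_intros continuous_intros simp: blinfun.diff_left fun_eq_iff)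
  show "I0 0 - I 0 = 0" by (simp add: I0_zero I_zero)
  show "open_cone Y" by (rule cone)
next
  fix u and s t :: real assume u: "u \<in> Y" and st: "0 < s" "s < t" and le: "(I0' (s *\<^sub>R u) - I' (s *\<^sub>R u)) u \<le> 0"
  have "I0' (t *\<^sub>R u) u / t powr (\<sigma> - 1) \<le> I0' (s *\<^sub>R u) u / s powr (\<sigma> - 1)"
    using monotone_onD[OF I0_slope[OF u], of s t] st by simp
  also have "\<dots> \<le> I' (s *\<^sub>R u) u / s powr (\<sigma> - 1)"
    using le by (intro divide_right_mono) (auto simp: blinfun.diff_left)
  also have "\<dots> < I' (t *\<^sub>R u) u / t powr (\<sigma> - 1)"
    using monotone_onD[OF I_slope[OF u], of s t] st by simp
  finally show "(I0' (t *\<^sub>R u) - I' (t *\<^sub>R u)) u < 0"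
    using st by (simp add: divide_less_cancel blinfun.diff_left)
next
  fix u assume u: "u \<in> Y"
  obtain \<rho> where \<rho>: "\<rho> > 0" "\<And>u. u \<in> Y \<Longrightarrow> norm u < \<rho> \<Longrightarrow> I' u u < C * norm u powr \<eta>"
    by (rule I'_small_near_zero) blast
  (* Any scaling of u into the ball of radius \<rho> would do; this one has norm \<rho> / 2. *)
  define s where "s = \<rho> / (2 * norm u)"
  have s: "s > 0" using cone_nonzero[OF u] \<rho>(1) by (simp add: s_def)
  then have su: "s *\<^sub>R u \<in> Y" using cone u by (simp add: open_cone_def)
  have "norm (s *\<^sub>R u) < \<rho>" using cone_nonzero[OF u] \<rho>(1) by (simp add: s_def)
  then have "I' (s *\<^sub>R u) (s *\<^sub>R u) < I0' (s *\<^sub>R u) (s *\<^sub>R u)"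
    using \<rho>(2)[OF su] coercive(3)[OF su] by linarith
  then have "0 < (I0' (s *\<^sub>R u) - I' (s *\<^sub>R u)) u"
    using s by (simp add: blinfun.scaleR_right blinfun.diff_left)
  with s show "\<exists>s>0. 0 < (I0' (s *\<^sub>R u) - I' (s *\<^sub>R u)) u" by blast
next
  fix u assume u: "u \<in> Y"
  have "\<forall>\<^sub>F t in at_top. \<forall>v\<in>{u}. \<Phi> (t *\<^sub>R v) < 0"
    using u by (intro negative_at_infinity) (auto simp: compactin_sing)
  then have "\<forall>\<^sub>F t in at_top. \<Phi> (t *\<^sub>R u) < 0 \<and> 0 < t"
    using eventually_gt_at_top[of "0 :: real"] by eventually_elim simp
  then obtain t where "\<Phi> (t *\<^sub>R u) < 0" "0 < t"
    using eventually_happens'[OF trivial_limit_at_top_linorder] by blast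
  then show "\<exists>t>0. I0 (t *\<^sub>R u) - I (t *\<^sub>R u) \<le> 0"
    by (intro exI[of _ t]) simp
qed

text \<open>A point of the weak closure that is not on the frontier is in the weak interior of
  \<open>Y\<close>. The frontier is taken in the weak topology, while \<open>Y\<close> itself is
  open in norm.\<close>

lemma weak_limit_cases:
  assumes "weakly_converges s u" "\<And>n. s n \<in> Y"
  obtains "u \<in> Y" | "u \<in> weak_topology frontier_of Y"
  using weak_limit_in_closure[OF assms] interior_of_subset[of weak_topology Y]
  unfolding frontier_of_def by blast

lemma nehari_balance: "u \<in> N \<Longrightarrow> I0' u u = I' u u"
  by (auto simp: nehari_set_iff blinfun.diff_left)

text \<open>The coercivity estimate integrated along the segment from \<open>0\<close> to
  \<open>u\<close>.\<close>

lemma I0_lower_bound: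
  assumes u: "u \<in> Y"
  shows "C / \<eta> * norm u powr \<eta> \<le> I0 u"
proof -
  let ?g = "\<lambda>t. I0 (t *\<^sub>R u) - C / \<eta> * norm u powr \<eta> * t powr \<eta>"
  have "?g 0 \<le> ?g 1"
  proof (rule DERIV_nonneg_imp_increasing_open[where f = ?g])
    fix t :: real assume t: "0 < t" "t < 1"
    have I0: "((\<lambda>t. I0 (t *\<^sub>R u)) has_real_derivative I0' (t *\<^sub>R u) u) (at t)"
      using C1_functional_line_derivative[OF I0_C1, of 0 u t] by simp
    have "(?g has_real_derivative I0' (t *\<^sub>R u) u - C * norm u powr \<eta> * t powr (\<eta> - 1)) (at t)"
      using t coercive(2) by (auto intro!: derivative_eq_intros I0)
    moreover have "C * (t * norm u) powr \<eta> \<le> t * I0' (t *\<^sub>R u) u"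
      using coercive(3)[OF scale_in_cone[OF t(1) u]] t by (simp add: blinfun.scaleR_right)
    then have "C * norm u powr \<eta> * t powr (\<eta> - 1) \<le> I0' (t *\<^sub>R u) u"
      using t by (simp add: powr_mult powr_diff field_simps)
    ultimately show "\<exists>y. (?g has_real_derivative y) (at t) \<and> 0 \<le> y"
      by (metis diff_ge_0_iff_ge)
  next
    have "continuous_on {0..1} (\<lambda>t. I0 (t *\<^sub>R u))"
      using C1_functional_line_derivative[OF I0_C1, of 0 u]
      by (intro continuous_at_imp_continuous_on ballI DERIV_isCont) simp
    then show "continuous_on {0..1} ?g"
      using coercive(2) by (intro continuous_on_diff continuous_on_mult continuous_on_const
          continuous_on_powr' continuous_on_id) auto
  qed simp
  then show ?thesis by (simp add: I0_zero I_zero)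
qed

text \<open>Otherwise take Nehari points \<open>y k\<close> in the sublevel set whose norms
  diverge, and a weak limit \<open>w\<close> of their normalizations \<open>v k\<close>. If
  \<open>w \<in> Y\<close>, then \<open>w\<close> and the subsequence form a weakly compact
  subset of \<open>Y\<close>, on which \<open>\<Phi>\<close> is eventually negative uniformly,
  although \<open>\<Phi> (y k) > 0\<close>. If \<open>w\<close> lies on the frontier, then for
  each \<open>t\<close> the values \<open>\<Phi> (t v k) \<le> \<Phi> (y k)\<close> stay below
  \<open>b\<close>, but \<open>I (t v k)\<close> tends to \<open>0\<close> and \<open>I0 (t v
  k)\<close> is at least \<open>C / \<eta> * t powr \<eta>\<close>.\<close>

lemma nehari_sublevel_bounded: "bounded {u \<in> N. \<Phi> u \<le> b}"
proof (rule ccontr)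
  assume "\<not> bounded {u \<in> N. \<Phi> u \<le> b}"
  then have "\<forall>k. \<exists>u. u \<in> N \<and> \<Phi> u \<le> b \<and> real k < norm u"
    unfolding bounded_iff by (metis (mono_tags, lifting) mem_Collect_eq not_le)
  then obtain y where y: "\<And>k. y k \<in> N" "\<And>k. \<Phi> (y k) \<le> b" "\<And>k. real k < norm (y k)"
    by metis
  define v where "v k = (1 / norm (y k)) *\<^sub>R y k" for k
  have pos: "norm (y k) > 0" for k using cone_nonzero y(1) by simp
  have y_eq: "y k = norm (y k) *\<^sub>R v k" for k using pos[of k] by (simp add: v_def)
  have v_Y: "v k \<in> Y" for k
    unfolding v_def using pos y(1) by (intro scale_in_cone) auto
  have v_norm: "norm (v k) = 1" for k using pos[of k] by (simp add: v_def)
  obtain r w where r: "strict_mono r" and w: "weakly_converges (v \<circ> r) w"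
    by (rule reflexive_bounded_weakly_convergent_subsequence[OF reflexive, of v 1]) (simp_all add: v_norm)
  from w show False
  proof (rule weak_limit_cases)
    show "(v \<circ> r) n \<in> Y" for n by (simp add: v_Y)
  next
    assume "w \<in> Y"
    then have "\<forall>\<^sub>F t in at_top. \<forall>u \<in> insert w (range (v \<circ> r)). \<Phi> (t *\<^sub>R u) < 0"
      using v_Y by (intro negative_at_infinity weakly_compact_sequence_with_limit w) auto
    then obtain T where T: "\<And>t k. T \<le> t \<Longrightarrow> \<Phi> (t *\<^sub>R v (r k)) < 0"
      unfolding eventually_at_top_linorder by auto
    obtain k :: nat where "T \<le> real k" using real_arch_simple by blast
    also have "real k \<le> real (r k)" using seq_suble[OF r, of k] by simp
    also have "\<dots> \<le> norm (y (r k))" using y(3)[of "r k"] by simp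
    finally have "\<Phi> (norm (y (r k)) *\<^sub>R v (r k)) < 0" by (rule T)
    then show False using nehari_positive[of "y (r k)"] y(1)[of "r k"] y_eq[of "r k"] by simp
  next
    assume w_frontier: "w \<in> weak_topology frontier_of Y"
    have bound: "C / \<eta> * t powr \<eta> \<le> b" if "t > 0" for t
    proof -
      have "(\<lambda>n. I (t *\<^sub>R v (r n))) \<longlonglongrightarrow> I (t *\<^sub>R w)"
        using w v_norm that
        by (intro C1_functional_weakly_continuous[OF I_C1 completely_continuous, where B = t]
            weakly_converges_scaleR) (auto simp: o_def)
      moreover have "I (t *\<^sub>R w) = 0"
        using frontier weak_frontier_scaleR[OF scale_in_cone that w_frontier] by simp
      ultimately have "(\<lambda>n. b + I (t *\<^sub>R v (r n))) \<longlonglongrightarrow> b + 0"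
        by (intro tendsto_add tendsto_const) simp
      moreover have "C / \<eta> * t powr \<eta> \<le> b + I (t *\<^sub>R v (r n))" for n
      proof -
        let ?y = "y (r n)"
        have "\<Phi> (t *\<^sub>R v (r n)) = \<Phi> ((t / norm ?y) *\<^sub>R ?y)" by (simp add: v_def)
        also have "\<dots> \<le> \<Phi> ?y" using y(1)[of "r n"] that by (intro nehari_maximizes_on_ray) auto
        also have "\<dots> \<le> b" by (rule y(2))
        finally show ?thesis
          using I0_lower_bound[OF scale_in_cone[OF that v_Y], of "r n"] v_norm that by simp
      qed
      ultimately show ?thesis by (intro LIMSEQ_le_const) auto
    qed
    (* The solution of C / \<eta> * t powr \<eta> = \<bar>b\<bar> + 1. *)
    define t where "t = ((\<bar>b\<bar> + 1) * \<eta> / C) powr (1 / \<eta>)"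
    have base: "(\<bar>b\<bar> + 1) * \<eta> / C > 0" using coercive by simp
    then have "t powr \<eta> = (\<bar>b\<bar> + 1) * \<eta> / C"
      using coercive(1,2) by (simp add: t_def powr_powr)
    then have "C / \<eta> * t powr \<eta> = \<bar>b\<bar> + 1" using coercive by simp
    moreover have "t > 0" using base coercive by (simp add: t_def)
    ultimately show False using bound[of t] by simp
  qed
qed

lemma nehari_nonempty: "N \<noteq> {}"
proof -
  obtain u where "u \<in> Y" using cone by (auto simp: open_cone_def)
  then show ?thesis using ray_meets_nehari_set scale_in_cone by blast
qed

lemma nehari_bounded_below: "bdd_below (\<Phi> ` N)"
  using nehari_positive by (intro bdd_belowI2[where m = 0]) (auto simp: less_imp_le)

text \<open>On the Nehari set \<open>I' u u = I0' u u \<ge> C * \<rho> powr \<eta>\<close>. This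
  bound passes to weak limits of \<open>I' u u\<close>, but on the frontier \<open>I' u
  u\<close> vanishes.\<close>

lemma weak_limit_of_nehari_sequence:
  assumes s: "\<And>n. s n \<in> N" and bound: "\<And>n. norm (s n) \<le> B" and u: "weakly_converges s u"
  shows "u \<in> Y"
  using u
proof (rule weak_limit_cases)
  show "s n \<in> Y" for n using s by simp
next
  assume "u \<in> weak_topology frontier_of Y"
  then have "I' u u = 0" using frontier by simp
  moreover have "(\<lambda>n. I' (s n) (s n)) \<longlonglongrightarrow> I' u u"
    using completely_continuous u unfolding completely_continuous_def
    by (intro weak_limit_of_pairing[OF u bound]) simp
  ultimately have lim: "(\<lambda>n. I' (s n) (s n)) \<longlonglongrightarrow> 0" by simp
  obtain \<rho> where \<rho>: "\<rho> > 0" "\<And>u. u \<in> Y \<Longrightarrow> norm u < \<rho> \<Longrightarrow> I' u u < C * norm u powr \<eta>"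
    by (rule I'_small_near_zero) blast
  have "C * \<rho> powr \<eta> \<le> I' (s n) (s n)" for n
  proof -
    have le: "C * norm (s n) powr \<eta> \<le> I' (s n) (s n)"
      using coercive(3)[of "s n"] nehari_balance[OF s[of n]] s[of n] by simp
    then have "\<rho> \<le> norm (s n)" using \<rho>(2)[of "s n"] s[of n] by force
    then have "C * \<rho> powr \<eta> \<le> C * norm (s n) powr \<eta>"
      using \<rho>(1) coercive by (intro mult_left_mono powr_mono2) auto
    with le show ?thesis by simp
  qed
  then have "C * \<rho> powr \<eta> \<le> 0" by (intro LIMSEQ_le_const[OF lim]) auto
  moreover have "C * \<rho> powr \<eta> > 0" using coercive \<rho>(1) by simp
  ultimately show ?thesis by simp
qed

text \<open>The weak limit \<open>u\<close> of a minimizing sequence is scaled onto the Nehari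
  set only afterwards: \<open>\<Phi> (t u)\<close> is compared with the values \<open>\<Phi> (t
  s n)\<close>, and these do not exceed \<open>\<Phi> (s n)\<close> by ray maximality.\<close>

theorem nehari_minimum_attained:
  obtains w where "w \<in> N" "\<Phi> w = Inf (\<Phi> ` N)"
proof -
  define c where "c = Inf (\<Phi> ` N)"
  have c_le: "c \<le> \<Phi> z" if "z \<in> N" for z
    unfolding c_def by (rule cInf_lower[OF imageI[OF that] nehari_bounded_below])
  have "\<exists>z\<in>N. \<Phi> z < c + 1 / real (Suc n)" for n
    using cInf_lessD[of "\<Phi> ` N" "c + 1 / real (Suc n)"] nehari_nonempty by (auto simp: c_def)
  then obtain s where s: "\<And>n. s n \<in> N" "\<And>n. \<Phi> (s n) < c + 1 / real (Suc n)" by metis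
  have "\<Phi> (s n) \<le> c + 1" for n
    using s(2)[of n] by (smt (verit) divide_le_eq_1 of_nat_0_less_iff of_nat_Suc of_nat_0_le_iff)
  then have "range s \<subseteq> {z \<in> N. \<Phi> z \<le> c + 1}" using s(1) by auto
  then have "bounded (range s)" by (rule bounded_subset[OF nehari_sublevel_bounded])
  then obtain B where B: "\<And>n. norm (s n) \<le> B" by (auto simp: bounded_iff)
  obtain r u where r: "strict_mono r" and u: "weakly_converges (s \<circ> r) u"
    using B by (rule reflexive_bounded_weakly_convergent_subsequence[OF reflexive])
  have "u \<in> Y"
    by (rule weak_limit_of_nehari_sequence[OF _ _ u, where B = B]) (simp_all add: s B del: Int_iff)
  then obtain t where t: "t > 0" "t *\<^sub>R u \<in> nehari_set \<Phi>" by (rule ray_meets_nehari_set)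
  have w: "t *\<^sub>R u \<in> N" using t \<open>u \<in> Y\<close> scale_in_cone by simp
  have tu: "weakly_converges (\<lambda>n. t *\<^sub>R s (r n)) (t *\<^sub>R u)"
    using weakly_converges_scaleR[OF u] by (simp add: o_def)
  have "I0 (t *\<^sub>R u) \<le> c + 0 + I (t *\<^sub>R u)"
  proof (rule weakly_lsc_le_limit[OF lsc tu])
    fix n
    have "\<Phi> (t *\<^sub>R s (r n)) \<le> \<Phi> (s (r n))"
      using s(1)[of "r n"] t(1) by (intro nehari_maximizes_on_ray) auto
    then show "I0 (t *\<^sub>R s (r n)) \<le> c + 1 / real (Suc (r n)) + I (t *\<^sub>R s (r n))"
      using s(2)[of "r n"] by simp
  next
    have "(\<lambda>n. I (t *\<^sub>R s (r n))) \<longlonglongrightarrow> I (t *\<^sub>R u)"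
      using B t(1)
      by (intro C1_functional_weakly_continuous[OF I_C1 completely_continuous tu, where B = "t * B"])
        simp
    moreover have "(\<lambda>n. 1 / real (Suc (r n))) \<longlonglongrightarrow> 0"
      using LIMSEQ_subseq_LIMSEQ[OF lim_1_over_n[THEN LIMSEQ_Suc] r] by (simp add: o_def)
    ultimately show "(\<lambda>n. c + 1 / real (Suc (r n)) + I (t *\<^sub>R s (r n))) \<longlonglongrightarrow> c + 0 + I (t *\<^sub>R u)"
      by (intro tendsto_add tendsto_const)
  qed
  then have "\<Phi> (t *\<^sub>R u) = c" using c_le[OF w] by simp
  with w that show thesis by (simp add: c_def)
qed

end

theorem corollary3p1:
  fixes \<Phi> I0 I :: "'a::banach \<Rightarrow> real"
    and I0' I' :: "'a \<Rightarrow> 'a \<Rightarrow>\<^sub>L real"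
    and Y :: "'a set"
    and C \<eta> \<sigma> c :: real
  assumes reflexive: "reflexive_space TYPE('a)"
    and cone: "open_cone Y"
    and C1: "C1_functional I0 I0'" "C1_functional I I'"
    and zero: "I0 0 = 0" "I 0 = 0"
    and Phi: "\<Phi> = (\<lambda>u. I0 u - I u)"
    and h1: "weakly_lsc I0" "weakly_lsc (\<lambda>u. I0' u u)" "completely_continuous I'"
    and h2: "C > 0" "\<eta> > 1"
      "\<And>u. u \<in> weak_topology closure_of Y \<Longrightarrow> I0' u u \<ge> C * norm u powr \<eta>"
      "(\<lambda>u. norm (I' u))
         \<in> o[at 0 within (weak_topology closure_of Y)](\<lambda>u. norm u powr (\<eta> - 1))"
    and h3: "\<And>u. u \<in> weak_topology frontier_of Y \<Longrightarrow> I u = 0 \<and> I' u u = 0"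
    and h4: "\<sigma> > 1"
      "\<And>u. u \<in> Y \<Longrightarrow> antimono_on {0<..} (\<lambda>t. I0' (t *\<^sub>R u) u / t powr (\<sigma> - 1))"
      "\<And>u. u \<in> Y \<Longrightarrow> strict_mono_on {0<..} (\<lambda>t. I' (t *\<^sub>R u) u / t powr (\<sigma> - 1))"
      "\<And>K. K \<subseteq> Y \<Longrightarrow> compactin weak_topology K \<Longrightarrow>
         \<exists>M. \<forall>\<^sub>F t in at_top. \<forall>u\<in>K. I0 (t *\<^sub>R u) / t powr \<sigma> \<le> M"
      "\<And>K. K \<subseteq> Y \<Longrightarrow> compactin weak_topology K \<Longrightarrow>
         \<forall>M. \<forall>\<^sub>F t in at_top. \<forall>u\<in>K. I (t *\<^sub>R u) / t powr \<sigma> \<ge> M"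
    and c: "c = Inf (\<Phi> ` (nehari_set \<Phi> \<inter> Y))"
  shows "bdd_below (\<Phi> ` (nehari_set \<Phi> \<inter> Y)) \<and> c > 0 \<and>
      (\<exists>u \<in> nehari_set \<Phi> \<inter> Y. critical_point \<Phi> u \<and> \<Phi> u = c) \<and>
      ((\<forall>u. u \<notin> Y \<and> u \<noteq> 0 \<longrightarrow> I' u u \<le> 0 \<and> 0 < I0' u u) \<longrightarrow> ground_state_level \<Phi> c)"
proof -
  interpret nehari_splitting I0 I I0' I' Y C \<eta> \<sigma>
  proof
    show "C * norm u powr \<eta> \<le> I0' u u" if "u \<in> Y" for u
      using h2(3)[of u] that closure_of_subset[of Y weak_topology] by auto
  qed (use assms in blast)+
  obtain w where w: "w \<in> nehari_set \<Phi> \<inter> Y" "\<Phi> w = c"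
    using nehari_minimum_attained unfolding c Phi by blast
  have bdd: "bdd_below (\<Phi> ` (nehari_set \<Phi> \<inter> Y))"
    using nehari_bounded_below unfolding Phi .
  have c_le: "c \<le> \<Phi> z" if "z \<in> nehari_set \<Phi>" "z \<in> Y" for z
    unfolding c using that by (intro cInf_lower[OF _ bdd]) auto
  have critical: "critical_point \<Phi> w"
    using nehari_minimizer_critical[of w] w c_le unfolding Phi by blast
  have "ground_state_level \<Phi> c"
    if outside: "\<forall>u. u \<notin> Y \<and> u \<noteq> 0 \<longrightarrow> I' u u \<le> 0 \<and> 0 < I0' u u"
  proof -
    have "c \<le> \<Phi> v" if "v \<noteq> 0" "critical_point \<Phi> v" for v
    proof -
      have "(\<Phi> has_derivative (\<lambda>h. I0' v h - I' v h)) (at v)"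
        using C1 unfolding Phi C1_functional_def by (intro has_derivative_diff) auto
      moreover have zero_deriv: "(\<Phi> has_derivative (\<lambda>h. 0)) (at v)"
        using that(2) by (simp add: critical_point_def)
      ultimately have "(\<lambda>h. I0' v h - I' v h) = (\<lambda>h. 0)"
        by (rule has_derivative_unique)
      then have "I0' v v - I' v v = 0" by (rule fun_cong)
      then have "v \<in> Y" using outside \<open>v \<noteq> 0\<close> by force
      moreover have "v \<in> nehari_set \<Phi>"
        using frechet_derivative_at[OF zero_deriv] \<open>v \<noteq> 0\<close> unfolding nehari_set_def
        by (metis (mono_tags, lifting) mem_Collect_eq)
      ultimately show ?thesis using c_le by blast
    qed
    moreover have "w \<noteq> 0" using w(1) by (simp add: nehari_set_def)
    ultimately show ?thesis
      using w(2) critical unfolding ground_state_level_def ground_state_def by blast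
  qed
  moreover have "c > 0"
    using nehari_positive[of w] w unfolding Phi by auto
  ultimately show ?thesis using bdd w critical by blast
qed

end
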